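(* Let $f\in\mathscr{H}^2$ and suppose that $f$ has an analytic continuation to $\mathbb{C}_0$ of order $0$. Then \[\|f\|_{\mathscr{H}^2}^2=\lim_{\sigma\to0^+}\lim_{T\to\infty}\frac{1}{2T}\int_{-T}^T|f(\sigma+it)|^2\,dt.\]
   Context: Write $s=\sigma+it$ and, for real $\kappa$, $\mathbb{C}_\kappa=\{s=\sigma+it : \sigma>\kappa\}$. $\mathscr{H}^2$ is the Hilbert space of Dirichlet series $f(s)=\sum_{n\geq1}a_n n^{-s}$ with complex coefficients and $\|f\|_{\mathscr{H}^2}^2=\sum_{n\geq1}|a_n|^2<\infty$; such a series converges absolutely and is analytic in $\mathbb{C}_{1/2}$. An analytic continuation of $f$ to $\mathbb{C}_0$ is an analytic function on $\mathbb{C}_0$ that agrees with the sum of the series wherever the series converges in $\mathbb{C}_0$; it is again denoted $f$. An analytic function $f$ on $\mathbb{C}_\kappa$ is of finite order in $\mathbb{C}_\kappa$ if for every $\varepsilon>0$ there are constants $A,B$ such that $|f(\sigma+it)|\leq B(1+|t|)^A$ for all $\sigma\geq\kappa+\varepsilon$ and all real $t$. For such $f$ the Lindelöf order function is \[\mu_f(\sigma)=\limsup_{|t|\to\infty}\frac{\log|f(\sigma+it)|}{\log|t|},\qquad \sigma>\kappa.\] An analytic function $f$ has order $0$ in $\mathbb{C}_\kappa$ if it is of finite order in $\mathbb{C}_\kappa$ and $\mu_f(\sigma)\leq0$ for every $\sigma>\kappa$. *)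

theory Defs
  imports "HOL-Complex_Analysis.Complex_Analysis"
begin

definition half_plane :: "real \<Rightarrow> complex set" where
  "half_plane \<kappa> = {s. Re s > \<kappa>}"

text \<open>A Dirichlet series is represented by its coefficient sequence \<open>a\<close>, whose indices start
  at 1; the value \<open>a 0\<close> is never used.\<close>

definition dirichlet_term :: "(nat \<Rightarrow> complex) \<Rightarrow> complex \<Rightarrow> nat \<Rightarrow> complex" where
  "dirichlet_term a s n = a (Suc n) * of_nat (Suc n) powr (- s)"

definition H2 :: "(nat \<Rightarrow> complex) set" where
  "H2 = {a. summable (\<lambda>n. (norm (a (Suc n)))\<^sup>2)}"

definition H2_norm :: "(nat \<Rightarrow> complex) \<Rightarrow> real" where
  "H2_norm a = sqrt (\<Sum>n. (norm (a (Suc n)))\<^sup>2)"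

definition analytic_continuation_C0 :: "(nat \<Rightarrow> complex) \<Rightarrow> (complex \<Rightarrow> complex) \<Rightarrow> bool" where
  "analytic_continuation_C0 a f \<longleftrightarrow>
     f analytic_on half_plane 0 \<and>
     (\<forall>s\<in>half_plane 0. summable (dirichlet_term a s) \<longrightarrow> f s = (\<Sum>n. dirichlet_term a s n))"

definition finite_order :: "real \<Rightarrow> (complex \<Rightarrow> complex) \<Rightarrow> bool" where
  "finite_order \<kappa> f \<longleftrightarrow>
     f analytic_on half_plane \<kappa> \<and>
     (\<forall>\<epsilon>>0. \<exists>A B :: real. \<forall>\<sigma> t :: real. \<sigma> \<ge> \<kappa> + \<epsilon> \<longrightarrow>
        norm (f (Complex \<sigma> t)) \<le> B * (1 + \<bar>t\<bar>) powr A)"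

text \<open>The library has \<open>ln 0 = 0\<close>; in the order function a zero of \<open>f\<close> must contribute
  \<open>-\<infinity>\<close> instead. On the reals, \<^const>\<open>at_infinity\<close> is the filter
  \<open>\<bar>t\<bar> \<rightarrow> \<infinity>\<close>.\<close>

definition log_ereal :: "real \<Rightarrow> ereal" where
  "log_ereal x = (if x = 0 then -\<infinity> else ereal (ln x))"

definition lindelof_order :: "(complex \<Rightarrow> complex) \<Rightarrow> real \<Rightarrow> ereal" where
  "lindelof_order f \<sigma> =
     Limsup at_infinity (\<lambda>t::real. log_ereal (norm (f (Complex \<sigma> t))) / ereal (ln \<bar>t\<bar>))"

definition order_zero :: "real \<Rightarrow> (complex \<Rightarrow> complex) \<Rightarrow> bool" where
  "order_zero \<kappa> f \<longleftrightarrow> finite_order \<kappa> f \<and> (\<forall>\<sigma>>\<kappa>. lindelof_order f \<sigma> \<le> 0)"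

definition mean_square :: "(complex \<Rightarrow> complex) \<Rightarrow> real \<Rightarrow> real \<Rightarrow> real" where
  "mean_square f \<sigma> T = 1 / (2 * T) * integral {-T..T} (\<lambda>t. (norm (f (Complex \<sigma> t)))\<^sup>2)"

end

theory Submission
  imports Defs "HOL-Probability.Distributions" "HOL-Real_Asymp.Real_Asymp"
begin

text \<open>The limit function is \<open>M \<sigma> = (\<Sum>n. |a n|\<^sup>2 n powr (- 2 \<sigma>))\<close>, and it tends to
  \<open>(\<Sum>n. |a n|\<^sup>2)\<close> as \<open>\<sigma> \<rightarrow> 0\<close> by dominated convergence. The point is the mean value for a fixed
  \<open>\<sigma> > 0\<close>, where the Dirichlet series need not converge. The idea is to replace \<open>f\<close> by a smoothly
  truncated series whose length \<open>X\<close> is a small power of \<open>T\<close>.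

  With the Gaussian weight \<open>exp (w\<^sup>2)\<close>, Cauchy's integral formula on a long rectangle around \<open>w = 0\<close>
  expresses \<open>f s\<close> as the difference of the integrals of
  \<open>f (s + w) X powr w exp (w\<^sup>2) / (2 \<pi> \<i> w)\<close> over the lines \<open>Re w = 2\<close> and \<open>Re w = - \<sigma> / 2\<close>
  (\<open>perron_shift\<close>); the polynomial bound in a strip that comes with finite order, against the
  Gaussian decay, removes the horizontal sides. On the right line the series converges absolutely, so
  that integral is \<open>(\<Sum>n. a n n powr (- s) \<phi> (X / n))\<close> with a fixed cutoff \<open>\<phi>\<close> for which
  \<open>\<phi> y = O(y\<^sup>2)\<close> and \<open>\<phi> y \<rightarrow> 1\<close> as \<open>y \<rightarrow> \<infinity>\<close> (\<open>perron_exponential_series\<close>). On the left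
  line order zero gives \<open>|f (\<sigma> / 2 + \<i> u)| = O((1 + |u|) powr \<epsilon>)\<close>, so that integral is
  \<open>O(X powr (- \<sigma> / 2) T powr \<epsilon>)\<close> for \<open>|t| \<le> T\<close> (\<open>smoothing_error\<close>); with
  \<open>X = T powr (1 / 8)\<close> and \<open>\<epsilon> = \<sigma> / 32\<close> it tends to 0.

  The mean square of a series \<open>(\<Sum>n. b n n powr (- \<i> t))\<close> over \<open>[-T, T]\<close> differs from
  \<open>(\<Sum>n. |b n|\<^sup>2)\<close> by at most \<open>(\<Sum>n. n |b n|)\<^sup>2 / T\<close>, because \<open>1 / |ln m - ln n| \<le> m n\<close> for
  distinct positive integers (\<open>dirichlet_series_mean_square\<close>). For the truncated series the
  numerator is \<open>O(X ^ 4)\<close>, hence the error is \<open>O(T powr (- 1 / 2))\<close>, and the diagonal tends to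
  \<open>M \<sigma>\<close> by dominated convergence.\<close>

section \<open>Shifting a vertical line of integration\<close>

lemma gaussian_integrable: "integrable lborel (\<lambda>v::real. exp (- v\<^sup>2 / 2))"
  and gaussian_integral_le: "(LINT v|lborel. exp (- v\<^sup>2 / 2)) \<le> 2 * pi"
proof -
  have eq: "exp (- v\<^sup>2 / 2) = sqrt (2 * pi) * std_normal_density v" for v :: real
    by (simp add: std_normal_density_def)
  show "integrable lborel (\<lambda>v::real. exp (- v\<^sup>2 / 2))"
    unfolding eq by simp
  have "(LINT v|lborel. exp (- v\<^sup>2 / 2)) = sqrt (2 * pi)"
    unfolding eq by simp
  also have "\<dots> \<le> sqrt ((2 * pi)\<^sup>2)"
    using pi_gt3 by (intro real_sqrt_le_mono) (simp add: power2_eq_square)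
  also have "\<dots> = 2 * pi"
    by (rule real_sqrt_unique) auto
  finally show "(LINT v|lborel. exp (- v\<^sup>2 / 2)) \<le> 2 * pi" .
qed

text \<open>The contour integral \<open>1 / (2 \<pi> \<i>) \<integral> g w / w dw\<close> over the upward line \<open>Re w = c\<close>: since
  \<open>dw = \<i> dv\<close> there, the factor \<open>\<i>\<close> cancels.\<close>

definition perron :: "(complex \<Rightarrow> complex) \<Rightarrow> real \<Rightarrow> complex" where
  "perron g c = (LINT v|lborel. g (Complex c v) / Complex c v) / of_real (2 * pi)"

lemma norm_div_vertical_le:
  assumes "c \<noteq> 0" "norm z \<le> K"
  shows "norm (z / Complex c v) \<le> K / \<bar>c\<bar>"
  using assms abs_Re_le_cmod[of "Complex c v"]
  by (auto simp: norm_divide intro!: frac_le order_trans[OF norm_ge_zero])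

text \<open>On the line, \<open>|w| \<ge> |c|\<close>, so Gaussian decay of \<open>g\<close> controls everything; the constant is clean
  because the total mass \<open>sqrt (2 \<pi>)\<close> of the Gaussian is at most \<open>2 \<pi>\<close>.\<close>

lemma perron_integrable:
  assumes "c \<noteq> 0" and meas: "(\<lambda>v. g (Complex c v)) \<in> borel_measurable lborel"
    and bound: "\<And>v. norm (g (Complex c v)) \<le> K * exp (- v\<^sup>2 / 2)"
  shows "integrable lborel (\<lambda>v. g (Complex c v) / Complex c v)"
    and "norm (perron g c) \<le> K / \<bar>c\<bar>"
    and "(LINT v|lborel. norm (g (Complex c v) / Complex c v)) \<le> K / \<bar>c\<bar> * (2 * pi)"
proof -
  have K: "0 \<le> K"
    using order_trans[OF norm_ge_zero bound[of 0]] by simp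
  have b: "norm (g (Complex c v) / Complex c v) \<le> K / \<bar>c\<bar> * exp (- v\<^sup>2 / 2)" for v
    using norm_div_vertical_le[OF assms(1) bound, of v v] by simp
  have ig: "integrable lborel (\<lambda>v. K / \<bar>c\<bar> * exp (- v\<^sup>2 / 2))"
    by (intro integrable_mult_right gaussian_integrable)
  have "(\<lambda>v. Complex c v) \<in> borel_measurable lborel"
    unfolding Complex_eq by measurable
  then have meas': "(\<lambda>v. g (Complex c v) / Complex c v) \<in> borel_measurable lborel"
    using meas by measurable
  show int: "integrable lborel (\<lambda>v. g (Complex c v) / Complex c v)"
    by (rule Bochner_Integration.integrable_bound[OF ig meas'])
       (use b K in \<open>auto intro!: order_trans[OF b]\<close>)
  have "(LINT v|lborel. norm (g (Complex c v) / Complex c v))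
      \<le> (LINT v|lborel. K / \<bar>c\<bar> * exp (- v\<^sup>2 / 2))"
    by (rule integral_mono[OF integrable_norm[OF int] ig b])
  also have "\<dots> \<le> K / \<bar>c\<bar> * (2 * pi)"
    using K gaussian_integral_le by (simp add: mult_left_mono divide_right_mono)
  finally show *: "(LINT v|lborel. norm (g (Complex c v) / Complex c v)) \<le> K / \<bar>c\<bar> * (2 * pi)" .
  have "norm (LINT v|lborel. g (Complex c v) / Complex c v) \<le> K / \<bar>c\<bar> * (2 * pi)"
    using integral_norm_bound * by (rule order_trans)
  then show "norm (perron g c) \<le> K / \<bar>c\<bar>"
    by (simp add: perron_def norm_divide norm_mult field_simps)
qed

lemma integral_truncate_tendsto:
  fixes h :: "real \<Rightarrow> complex"
  assumes "integrable lborel h"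
  shows "((\<lambda>R. integral {-R..R} h) \<longlongrightarrow> integral\<^sup>L lborel h) at_top"
proof -
  have si: "set_integrable lborel {-R..R} h" for R
    using integrable_mult_indicator[OF _ assms, of "{-R..R}"] by (simp add: set_integrable_def)
  have "((\<lambda>R. LINT v|lborel. indicator {-R..R} v *\<^sub>R h v) \<longlongrightarrow> integral\<^sup>L lborel h) at_top"
  proof (rule integral_dominated_convergence_at_top[where w = "\<lambda>v. norm (h v)"])
    show "AE v in lborel. ((\<lambda>R. indicator {-R..R} v *\<^sub>R h v) \<longlongrightarrow> h v) at_top"
    proof (intro AE_I2 tendsto_eventually)
      fix v :: real
      show "eventually (\<lambda>R. indicator {-R..R} v *\<^sub>R h v = h v) at_top"
        using eventually_ge_at_top[of "\<bar>v\<bar>"] by eventually_elim (auto simp: indicator_def abs_le_iff)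
    qed
    show "\<forall>\<^sub>F R in at_top. AE v in lborel. norm (indicator {-R..R} v *\<^sub>R h v) \<le> norm (h v)"
      by (intro always_eventually allI AE_I2) (auto simp: indicator_def)
  qed (use assms in auto)
  then show ?thesis
    by (simp add: set_borel_integral_eq_integral(2)[OF si, symmetric] set_lebesgue_integral_def)
qed

text \<open>Moving the line across the pole of \<open>g w / w\<close> at 0 costs the residue \<open>g 0\<close>. This is Cauchy's
  formula on the rectangle of height \<open>2 R\<close>; the decay of \<open>g\<close> in the strip makes the horizontal
  sides vanish as \<open>R \<rightarrow> \<infinity>\<close>.\<close>

lemma perron_shift:
  assumes hol: "g holomorphic_on {w. Re w > r'}" and r: "r' < r" "r < 0" and c: "0 < c"
    and bound: "\<And>w. r \<le> Re w \<Longrightarrow> Re w \<le> c \<Longrightarrow> norm (g w) \<le> K * exp (- (Im w)\<^sup>2 / 2)"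
  shows "g 0 = perron g c - perron g r"
proof -
  define h where "h w = g w / w" for w
  define J where "J x = (LINT v|lborel. h (Complex x v))" for x
  have K: "0 \<le> K"
    using order_trans[OF norm_ge_zero bound[of 0]] r c by simp
  have cont: "continuous_on UNIV (\<lambda>v. g (Complex x v))" if "r \<le> x" for x
    by (rule continuous_on_compose2[OF holomorphic_on_imp_continuous_on[OF hol]])
       (use that r in \<open>auto simp: Complex_eq intro!: continuous_intros\<close>)
  have int: "integrable lborel (\<lambda>v. h (Complex x v))" if "r \<le> x" "x \<le> c" "x \<noteq> 0" for x
    unfolding h_def using that bound[of "Complex x _"] borel_measurable_continuous_onI[OF cont]
    by (intro perron_integrable(1)[where K = K]) auto
  \<comment> \<open>The two horizontal sides are all that separates the rectangle from the two vertical lines.\<close>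
  have rect: "norm (2 * pi * g 0 - (integral {-R..R} (\<lambda>v. h (Complex c v))
          - integral {-R..R} (\<lambda>v. h (Complex r v)))) \<le> 2 * (K * exp (- R\<^sup>2 / 2) / R * (c - r))"
    if R: "0 < R" for R
  proof -
    let ?p = "Complex r (-R)" and ?q = "Complex c (-R)" and ?p' = "Complex r R" and ?q' = "Complex c R"
    let ?\<gamma> = "rectpath ?p ?q'"
    have box: "0 \<in> box ?p ?q'"
      using R r c by (auto simp: in_box_complex_iff)
    have sub: "path_image ?\<gamma> \<subseteq> cbox ?p ?q' - box ?p ?q'"
      using R r c by (subst path_image_rectpath_cbox_minus_box) auto
    then have sub': "path_image ?\<gamma> \<subseteq> {w. r' < Re w} - {0}"
      using box r by (auto simp: in_cbox_complex_iff)
    have "((\<lambda>w. g w / (w - 0)) has_contour_integral (2 * pi * \<i> * winding_number ?\<gamma> 0 * g 0)) ?\<gamma>"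
    proof (rule Cauchy_integral_formula_convex_simple[OF _ hol])
      show "convex {w. r' < Re w}"
        by (rule convex_halfspace_Re_gt)
      show "0 \<in> interior {w. r' < Re w}"
        using r by (simp add: interior_open open_halfspace_Re_gt)
      show "path_image ?\<gamma> \<subseteq> {w. r' < Re w} - {0}"
        by (rule sub')
    qed auto
    then have ci: "(h has_contour_integral (2 * pi * \<i> * g 0)) ?\<gamma>"
      using winding_number_rectpath[OF box] by (simp add: h_def[abs_def])
    have cont_h: "continuous_on (closed_segment x y) h"
      if "closed_segment x y \<subseteq> path_image ?\<gamma>" for x y
      unfolding h_def using order_trans[OF that sub']
      by (intro continuous_intros holomorphic_on_imp_continuous_on holomorphic_on_subset[OF hol]) auto
    have img: "path_image ?\<gamma> = closed_segment ?p ?q \<union> closed_segment ?q ?q' \<union>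
        closed_segment ?q' ?p' \<union> closed_segment ?p' ?p"
      by (simp add: rectpath_def Let_def path_image_join Un_assoc)
    have cis: "h contour_integrable_on linepath ?p ?q" "h contour_integrable_on linepath ?q ?q'"
        "h contour_integrable_on linepath ?q' ?p'" "h contour_integrable_on linepath ?p' ?p"
      by (intro contour_integrable_continuous_linepath cont_h; simp add: img; blast)+
    have "2 * pi * \<i> * g 0 = contour_integral ?\<gamma> h"
      using contour_integral_unique[OF ci] by simp
    also have "\<dots> = contour_integral (linepath ?p ?q) h + contour_integral (linepath ?q ?q') h
        + contour_integral (linepath ?q' ?p') h + contour_integral (linepath ?p' ?p) h"
      using cis by (simp add: rectpath_def Let_def add_ac)
    also have "contour_integral (linepath ?p' ?p) h = - contour_integral (linepath ?p ?p') h"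
      by (metis contour_integral_reverse_linepath cont_h img sup_ge2 closed_segment_commute)
    also have "contour_integral (linepath ?p ?p') h = \<i> * integral {-R..R} (\<lambda>v. h (Complex r v))"
      by (rule contour_integral_linepath_same_Re) (use R in auto)
    also have "contour_integral (linepath ?q ?q') h = \<i> * integral {-R..R} (\<lambda>v. h (Complex c v))"
      by (rule contour_integral_linepath_same_Re) (use R in auto)
    finally have "\<i> * (2 * pi * g 0 - (integral {-R..R} (\<lambda>v. h (Complex c v))
          - integral {-R..R} (\<lambda>v. h (Complex r v)))) =
        contour_integral (linepath ?p ?q) h + contour_integral (linepath ?q' ?p') h"
      by (simp add: algebra_simps)
    then have "norm (2 * pi * g 0 - (integral {-R..R} (\<lambda>v. h (Complex c v))
          - integral {-R..R} (\<lambda>v. h (Complex r v)))) =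
        norm (contour_integral (linepath ?p ?q) h + contour_integral (linepath ?q' ?p') h)"
      by (metis norm_mult norm_ii mult_1)
    also have "\<dots> \<le> norm (contour_integral (linepath ?p ?q) h) + norm (contour_integral (linepath ?q' ?p') h)"
      by (rule norm_triangle_ineq)
    also have "\<dots> \<le> K * exp (- R\<^sup>2 / 2) / R * (c - r) + K * exp (- R\<^sup>2 / 2) / R * (c - r)"
    proof (rule add_mono)
      have hb: "norm (h w) \<le> K * exp (- R\<^sup>2 / 2) / R"
        if "r \<le> Re w" "Re w \<le> c" "\<bar>Im w\<bar> = R" for w
      proof -
        have "(Im w)\<^sup>2 = R\<^sup>2"
          using that(3) by auto
        then show ?thesis
          using bound[OF that(1,2)] abs_Im_le_cmod[of w] that(3) R
          by (auto simp: h_def norm_divide intro!: frac_le order_trans[OF norm_ge_zero])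
      qed
      have d: "norm (Complex x y - Complex x' y) = \<bar>x - x'\<bar>" for x x' y
        by (simp add: cmod_def)
      have "norm (contour_integral (linepath ?p ?q) h) \<le> K * exp (- R\<^sup>2 / 2) / R * norm (?q - ?p)"
        using K R r c
        by (intro contour_integral_bound_linepath cis hb)
           (auto simp: closed_segment_same_Im closed_segment_eq_real_ivl)
      then show "norm (contour_integral (linepath ?p ?q) h) \<le> K * exp (- R\<^sup>2 / 2) / R * (c - r)"
        unfolding d using r c by (simp add: abs_if)
      have "norm (contour_integral (linepath ?q' ?p') h) \<le> K * exp (- R\<^sup>2 / 2) / R * norm (?p' - ?q')"
        using K R r c
        by (intro contour_integral_bound_linepath cis hb)
           (auto simp: closed_segment_same_Im closed_segment_eq_real_ivl)
      then show "norm (contour_integral (linepath ?q' ?p') h) \<le> K * exp (- R\<^sup>2 / 2) / R * (c - r)"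
        unfolding d using r c by (simp add: abs_if)
    qed
    finally show ?thesis by (simp only: mult_2)
  qed
  have lim1: "((\<lambda>R. norm (2 * pi * g 0 - (integral {-R..R} (\<lambda>v. h (Complex c v))
          - integral {-R..R} (\<lambda>v. h (Complex r v))))) \<longlongrightarrow> norm (2 * pi * g 0 - (J c - J r))) at_top"
    unfolding J_def using r c by (intro tendsto_intros integral_truncate_tendsto int) auto
  have lim2: "((\<lambda>R. 2 * (K * exp (- R\<^sup>2 / 2) / R * (c - r))) \<longlongrightarrow> 0) at_top"
    by real_asymp
  have "norm (2 * pi * g 0 - (J c - J r)) \<le> 0"
    by (rule tendsto_le[OF _ lim2 lim1 eventually_mono[OF eventually_gt_at_top[of 0] rect]]) auto
  then have "2 * pi * g 0 = J c - J r"
    by simp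
  then show ?thesis
    by (simp add: perron_def J_def h_def field_simps)
qed

section \<open>The smooth cutoff\<close>

text \<open>\<open>X powr w\<close> times the Gaussian weight, with \<open>L = ln X\<close>. The weight equals 1 at 0, so it does not
  change the residue, and its decay on vertical lines beats every power of the height.\<close>

definition gauss_kernel :: "real \<Rightarrow> complex \<Rightarrow> complex" where
  "gauss_kernel L w = exp (w * of_real L + w\<^sup>2)"

lemma norm_gauss_kernel: "norm (gauss_kernel L w) = exp (Re w * L + (Re w)\<^sup>2) * exp (- (Im w)\<^sup>2)"
  by (simp add: gauss_kernel_def norm_exp_eq_Re power2_eq_square flip: exp_add)

lemma gauss_kernel_measurable [measurable]: "(\<lambda>v. gauss_kernel L (Complex c v)) \<in> borel_measurable borel"
  unfolding gauss_kernel_def Complex_eq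
  by (intro borel_measurable_continuous_onI continuous_intros)

lemma holomorphic_gauss_kernel [holomorphic_intros]: "gauss_kernel L holomorphic_on S"
  unfolding gauss_kernel_def by (intro holomorphic_intros)

lemma gauss_kernel_0 [simp]: "gauss_kernel L 0 = 1"
  by (simp add: gauss_kernel_def)

lemma norm_gauss_kernel_le: "norm (gauss_kernel L w) \<le> exp (Re w * L + (Re w)\<^sup>2) * exp (- (Im w)\<^sup>2 / 2)"
  unfolding norm_gauss_kernel by (intro mult_left_mono) auto

text \<open>As a function of \<open>y = exp L\<close> this is a smooth replacement for the indicator of \<open>y \<ge> 1\<close>. The
  two bounds on it below come from integrating over different lines.\<close>

definition cutoff :: "real \<Rightarrow> complex" where
  "cutoff L = perron (gauss_kernel L) 2"

lemma cutoff_decay: "norm (cutoff L) \<le> exp (2 * L + 4)"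
proof -
  have "norm (cutoff L) \<le> exp (2 * L + 4) / \<bar>2\<bar>"
    unfolding cutoff_def
    by (rule perron_integrable(2)) (use norm_gauss_kernel_le[of L "Complex 2 _"] in auto)
  also have "\<dots> \<le> exp (2 * L + 4)"
    by simp
  finally show ?thesis .
qed

lemma strip_exponent_le:
  fixes x L m :: real
  assumes "\<bar>x\<bar> \<le> m"
  shows "exp (x * L + x\<^sup>2) \<le> exp (m * \<bar>L\<bar> + m\<^sup>2)"
proof -
  have "x * L \<le> \<bar>x\<bar> * \<bar>L\<bar>"
    by (simp flip: abs_mult)
  also have "\<dots> \<le> m * \<bar>L\<bar>"
    using assms by (rule mult_right_mono) auto
  finally have "x * L \<le> m * \<bar>L\<bar>" .
  moreover have "x\<^sup>2 \<le> m\<^sup>2"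
    using assms by (simp add: abs_le_square_iff[symmetric])
  ultimately show ?thesis by simp
qed

text \<open>Shifting the line from 2 to \<open>- 1\<close> picks up the residue 1 and leaves an integral of size
  \<open>exp (- L)\<close>.\<close>

lemma cutoff_near_one: "norm (cutoff L - 1) \<le> exp (1 - L)"
proof -
  have "gauss_kernel L 0 = perron (gauss_kernel L) 2 - perron (gauss_kernel L) (-1)"
  proof (rule perron_shift[where r' = "-2" and K = "exp (2 * \<bar>L\<bar> + 2\<^sup>2)"])
    fix w :: complex assume "-1 \<le> Re w" "Re w \<le> 2"
    then have "exp (Re w * L + (Re w)\<^sup>2) \<le> exp (2 * \<bar>L\<bar> + 2\<^sup>2)"
      by (intro strip_exponent_le) auto
    then show "norm (gauss_kernel L w) \<le> exp (2 * \<bar>L\<bar> + 2\<^sup>2) * exp (- (Im w)\<^sup>2 / 2)"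
      by (intro order_trans[OF norm_gauss_kernel_le] mult_right_mono) auto
  qed (auto intro: holomorphic_gauss_kernel)
  then have "cutoff L - 1 = perron (gauss_kernel L) (-1)"
    by (simp add: cutoff_def algebra_simps)
  then have "norm (cutoff L - 1) = norm (perron (gauss_kernel L) (-1))"
    by simp
  also have "\<dots> \<le> exp (1 - L) / \<bar>-1\<bar>"
    by (rule perron_integrable(2)) (use norm_gauss_kernel_le[of L "Complex (-1) _"] in auto)
  finally show ?thesis by simp
qed

lemma cutoff_bounded: "norm (cutoff L) \<le> exp 4"
proof (cases "L \<le> 0")
  case True
  then show ?thesis
    by (intro order_trans[OF cutoff_decay]) simp
next
  case False
  have "norm (cutoff L) \<le> norm (cutoff L - 1) + norm (1::complex)"
    using norm_triangle_ineq[of "cutoff L - 1" 1] by simp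
  also have "\<dots> \<le> exp 1 + exp 1"
    using cutoff_near_one[of L] False by (intro add_mono) (auto intro: order_trans)
  also have "\<dots> = 2 * exp 1"
    by simp
  also have "\<dots> \<le> exp 1 * exp (1::real)"
    using exp_ge_add_one_self[of 1] by (intro mult_right_mono) auto
  also have "\<dots> \<le> exp 4"
    by (simp flip: exp_add)
  finally show ?thesis .
qed

lemma cutoff_tendsto_one: "(cutoff \<longlongrightarrow> 1) at_top"
proof -
  have "((\<lambda>L. exp (1 - L) :: real) \<longlongrightarrow> 0) at_top"
    by real_asymp
  then have "((\<lambda>L. cutoff L - 1) \<longlongrightarrow> 0) at_top"
    by (rule Lim_null_comparison[rotated]) (rule always_eventually, rule allI, rule cutoff_near_one)
  then show ?thesis
    by (simp add: LIM_zero_iff)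
qed

text \<open>Termwise integration: multiplying by \<open>exp (- w * l n)\<close> only translates \<open>L\<close> by \<open>l n\<close> in the
  kernel, so each term produces one value of the cutoff.\<close>

lemma perron_exponential_series:
  fixes b :: "nat \<Rightarrow> complex" and l :: "nat \<Rightarrow> real"
  assumes sums: "\<And>v. (\<lambda>n. b n * exp (- Complex 2 v * l n)) sums g (Complex 2 v)"
    and abs: "summable (\<lambda>n. norm (b n) * exp (- 2 * l n))"
  shows "(\<lambda>n. b n * cutoff (L - l n)) sums perron (\<lambda>w. g w * gauss_kernel L w) 2"
proof -
  have ker: "gauss_kernel (L - l n) w = exp (- w * l n) * gauss_kernel L w" for n w
    by (simp add: gauss_kernel_def algebra_simps flip: exp_add)
  have kb: "norm (gauss_kernel (L - l n) (Complex 2 v)) \<le> exp (2 * L + 4) * exp (- 2 * l n) * exp (- v\<^sup>2 / 2)" for n v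
    using norm_gauss_kernel_le[of "L - l n" "Complex 2 v"] by (simp add: algebra_simps flip: exp_add)
  note int = perron_integrable[OF _ _ kb, simplified]
  define h where "h n v = b n * (gauss_kernel (L - l n) (Complex 2 v) / Complex 2 v)" for n v
  have nh: "norm (h n v) = norm (b n) * norm (gauss_kernel (L - l n) (Complex 2 v) / Complex 2 v)" for n v
    unfolding h_def by (rule norm_mult)
  have hs: "(\<lambda>n. h n v) sums (g (Complex 2 v) * gauss_kernel L (Complex 2 v) / Complex 2 v)" for v
    using sums_mult2[OF sums, of v "gauss_kernel L (Complex 2 v) / Complex 2 v"]
    by (simp add: h_def ker algebra_simps)
  have "(\<lambda>n. integral\<^sup>L lborel (h n)) sums (LINT v|lborel. (\<Sum>n. h n v))"
  proof (rule sums_integral)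
    show "integrable lborel (h n)" for n
      unfolding h_def using int(1) by (intro integrable_mult_right) 
    have "norm (h n v) \<le> norm (b n) * exp (- 2 * l n) * (exp (2 * L + 4) / 2)" for n v
    proof -
      have "norm (gauss_kernel (L - l n) (Complex 2 v) / Complex 2 v)
          \<le> exp (2 * L + 4) * exp (- 2 * l n) * exp (- v\<^sup>2 / 2) / \<bar>2\<bar>"
        by (rule norm_div_vertical_le) (use kb in auto)
      also have "\<dots> \<le> exp (2 * L + 4) * exp (- 2 * l n) / \<bar>2\<bar>"
        by (intro divide_right_mono mult_left_le) auto
      finally have "norm (b n) * norm (gauss_kernel (L - l n) (Complex 2 v) / Complex 2 v)
          \<le> norm (b n) * (exp (2 * L + 4) * exp (- 2 * l n) / \<bar>2\<bar>)"
        by (intro mult_left_mono) auto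
      then show ?thesis
        by (simp add: nh algebra_simps)
    qed
    then have "summable (\<lambda>n. norm (h n v))" for v
      by (intro summable_comparison_test'[OF summable_mult2[OF abs, of "exp (2 * L + 4) / 2"]]) auto
    then show "AE v in lborel. summable (\<lambda>n. norm (h n v))"
      by simp
    have "(LINT v|lborel. norm (h n v)) \<le> norm (b n) * exp (- 2 * l n) * (exp (2 * L + 4) / 2 * (2 * pi))" for n
    proof -
      have "(LINT v|lborel. norm (gauss_kernel (L - l n) (Complex 2 v) / Complex 2 v))
          \<le> exp (2 * L + 4) * exp (- 2 * l n) / \<bar>2\<bar> * (2 * pi)"
        by (rule perron_integrable(3)) (use kb in auto)
      then have "norm (b n) * (LINT v|lborel. norm (gauss_kernel (L - l n) (Complex 2 v) / Complex 2 v))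
          \<le> norm (b n) * (exp (2 * L + 4) * exp (- 2 * l n) / \<bar>2\<bar> * (2 * pi))"
        by (rule mult_left_mono) auto
      then show ?thesis
        unfolding nh by (simp add: algebra_simps)
    qed
    then show "summable (\<lambda>n. LINT v|lborel. norm (h n v))"
      by (intro summable_comparison_test'[OF summable_mult2[OF abs, of "exp (2 * L + 4) / 2 * (2 * pi)"]]) auto
  qed
  then have "(\<lambda>n. integral\<^sup>L lborel (h n) / of_real (2 * pi)) sums
      ((LINT v|lborel. (\<Sum>n. h n v)) / of_real (2 * pi))"
    by (rule sums_divide)
  moreover have "integral\<^sup>L lborel (h n) / of_real (2 * pi) = b n * cutoff (L - l n)" for n
    unfolding h_def cutoff_def perron_def integral_mult_right_zero by simp
  moreover have "(\<lambda>v. \<Sum>n. h n v) = (\<lambda>v. g (Complex 2 v) * gauss_kernel L (Complex 2 v) / Complex 2 v)"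
    using hs by (auto intro: sums_unique[symmetric])
  ultimately show ?thesis
    by (simp add: perron_def)
qed

section \<open>Functions of order zero\<close>

text \<open>The order function controls only large \<open>|t|\<close>; for bounded \<open>|t|\<close> the estimate comes from the
  finite order bound, so the result holds for all \<open>t\<close> with one constant.\<close>

lemma order_zero_bound:
  assumes "order_zero 0 f" "0 < \<sigma>" "0 < \<epsilon>"
  obtains C where "0 \<le> C" "\<And>t. norm (f (Complex \<sigma> t)) \<le> C * (1 + \<bar>t\<bar>) powr \<epsilon>"
proof -
  have "lindelof_order f \<sigma> < ereal \<epsilon>"
    by (rule le_less_trans[of _ 0]) (use assms in \<open>auto simp: order_zero_def\<close>)
  then have "\<forall>\<^sub>F t in at_infinity. log_ereal (norm (f (Complex \<sigma> t))) / ereal (ln \<bar>t\<bar>) < ereal \<epsilon>"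
    unfolding lindelof_order_def by (rule Limsup_lessD)
  then obtain b where b: "\<And>t. b \<le> \<bar>t\<bar> \<Longrightarrow> log_ereal (norm (f (Complex \<sigma> t))) / ereal (ln \<bar>t\<bar>) < ereal \<epsilon>"
    by (auto simp: eventually_at_infinity)
  have "\<exists>A B. \<forall>\<sigma>' t. \<sigma>' \<ge> 0 + \<sigma> \<longrightarrow> norm (f (Complex \<sigma>' t)) \<le> B * (1 + \<bar>t\<bar>) powr A"
    using assms unfolding order_zero_def finite_order_def by blast
  then obtain A B where AB: "norm (f (Complex \<sigma> t)) \<le> B * (1 + \<bar>t\<bar>) powr A" for t
    by fastforce
  define C where "C = 1 + \<bar>B\<bar> * (1 + (2 + \<bar>b\<bar>)) powr \<bar>A\<bar>"
  have "norm (f (Complex \<sigma> t)) \<le> C * (1 + \<bar>t\<bar>) powr \<epsilon>" for t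
  proof (cases "2 + \<bar>b\<bar> \<le> \<bar>t\<bar>")
    case True
    have "norm (f (Complex \<sigma> t)) \<le> \<bar>t\<bar> powr \<epsilon>"
    proof (cases "f (Complex \<sigma> t) = 0")
      case False
      have "b \<le> \<bar>t\<bar>" "0 < ln \<bar>t\<bar>"
        using True by auto
      then have "ln (norm (f (Complex \<sigma> t))) / ln \<bar>t\<bar> < \<epsilon>"
        using b[of t] False by (simp add: log_ereal_def)
      then have "ln (norm (f (Complex \<sigma> t))) < \<epsilon> * ln \<bar>t\<bar>"
        using \<open>0 < ln \<bar>t\<bar>\<close> by (simp add: field_simps)
      then have "exp (ln (norm (f (Complex \<sigma> t)))) \<le> exp (\<epsilon> * ln \<bar>t\<bar>)"
        by simp
      then show ?thesis
        using False True by (simp add: powr_def split: if_splits)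
    qed auto
    also have "\<dots> \<le> (1 + \<bar>t\<bar>) powr \<epsilon>"
      using assms by (intro powr_mono2) auto
    also have "\<dots> \<le> C * (1 + \<bar>t\<bar>) powr \<epsilon>"
      by (simp add: C_def mult_le_cancel_right1)
    finally show ?thesis .
  next
    case False
    have "norm (f (Complex \<sigma> t)) \<le> B * (1 + \<bar>t\<bar>) powr A"
      by (rule AB)
    also have "\<dots> \<le> \<bar>B\<bar> * (1 + \<bar>t\<bar>) powr \<bar>A\<bar>"
      by (intro mult_mono powr_mono) auto
    also have "\<dots> \<le> \<bar>B\<bar> * (1 + (2 + \<bar>b\<bar>)) powr \<bar>A\<bar>"
      using False by (intro mult_left_mono powr_mono2) auto
    also have "\<dots> \<le> C * 1"
      by (simp add: C_def)
    also have "\<dots> \<le> C * (1 + \<bar>t\<bar>) powr \<epsilon>"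
      using assms by (intro mult_left_mono ge_one_powr_ge_zero) (auto simp: C_def)
    finally show ?thesis .
  qed
  moreover have "0 \<le> C"
    by (simp add: C_def)
  ultimately show ?thesis
    using that by blast
qed

text \<open>Separates the height \<open>t\<close> of the point from the height \<open>v\<close> on the line of integration. Half of
  the decay \<open>exp (- v\<^sup>2)\<close> of the kernel pays for the growth in \<open>v\<close>; the other half remains for
  integration.\<close>

lemma polynomial_growth_le_gaussian:
  fixes t v A :: real
  assumes "0 \<le> A"
  shows "(1 + \<bar>t + v\<bar>) powr A \<le> (1 + \<bar>t\<bar>) powr A * (exp (A\<^sup>2 / 2) * exp (v\<^sup>2 / 2))"
proof -
  have "1 + \<bar>t + v\<bar> \<le> (1 + \<bar>t\<bar>) * (1 + \<bar>v\<bar>)"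
    using abs_triangle_ineq[of t v] by (auto simp: algebra_simps intro: order_trans)
  then have "(1 + \<bar>t + v\<bar>) powr A \<le> ((1 + \<bar>t\<bar>) * (1 + \<bar>v\<bar>)) powr A"
    using assms by (intro powr_mono2) auto
  also have "\<dots> = (1 + \<bar>t\<bar>) powr A * (1 + \<bar>v\<bar>) powr A"
    by (rule powr_mult) 
  also have "(1 + \<bar>v\<bar>) powr A \<le> exp \<bar>v\<bar> powr A"
    using assms by (intro powr_mono2 exp_ge_add_one_self) auto
  also have "\<dots> = exp (A * \<bar>v\<bar>)"
    by (simp add: powr_def)
  also have "\<dots> \<le> exp (A\<^sup>2 / 2 + v\<^sup>2 / 2)"
    using sum_squares_bound[of A "\<bar>v\<bar>"] by simp
  finally show ?thesis
    by (simp add: exp_add mult_left_mono)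
qed

text \<open>The difference is the integral over \<open>Re w = - \<sigma> / 2\<close>, which sees \<open>f\<close> on the line of real part
  \<open>\<sigma> / 2\<close> only. The finite order bound, with its uncontrolled exponent, serves just to justify
  the shift; the final estimate uses the small exponent that order zero provides on the one line.\<close>

lemma smoothing_error:
  assumes f: "order_zero 0 f" and "0 < \<sigma>" "0 < \<epsilon>"
  obtains C where "0 \<le> C"
    "\<And>L t. norm (f (Complex \<sigma> t) - perron (\<lambda>w. f (Complex \<sigma> t + w) * gauss_kernel L w) 2)
        \<le> C * exp (- (\<sigma> / 2) * L) * (1 + \<bar>t\<bar>) powr \<epsilon>"
proof -
  have hol: "f holomorphic_on {s. Re s > 0}"
    using f by (auto simp: order_zero_def finite_order_def half_plane_def intro: analytic_imp_holomorphic)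
  obtain C\<^sub>0 where C0: "0 \<le> C\<^sub>0" "\<And>t. norm (f (Complex (\<sigma> / 2) t)) \<le> C\<^sub>0 * (1 + \<bar>t\<bar>) powr \<epsilon>"
    using order_zero_bound[OF f, of "\<sigma> / 2" \<epsilon>] assms by auto
  have "\<exists>A B. \<forall>\<sigma>' t. \<sigma>' \<ge> 0 + \<sigma> / 2 \<longrightarrow> norm (f (Complex \<sigma>' t)) \<le> B * (1 + \<bar>t\<bar>) powr A"
    using assms unfolding order_zero_def finite_order_def by (meson half_gt_zero)
  then obtain A B where AB: "\<And>\<sigma>' t. \<sigma>' \<ge> \<sigma> / 2 \<Longrightarrow> norm (f (Complex \<sigma>' t)) \<le> B * (1 + \<bar>t\<bar>) powr A"
    by auto
  define g where "g L t w = f (Complex \<sigma> t + w) * gauss_kernel L w" for L t w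
  have gauss: "exp (v\<^sup>2 / 2) * exp (- v\<^sup>2) = exp (- v\<^sup>2 / 2)" for v :: real
    by (simp flip: exp_add)
  have split: "Complex \<sigma> t + w = Complex (\<sigma> + Re w) (t + Im w)" for t w
    by (simp add: complex_eq_iff)
  have meas: "(\<lambda>v. g L t (Complex x v)) \<in> borel_measurable borel" if "- \<sigma> < x" for L t x
  proof -
    have "continuous_on UNIV (\<lambda>v. f (Complex \<sigma> t + Complex x v))"
      by (rule continuous_on_compose2[OF holomorphic_on_imp_continuous_on[OF hol]])
         (use that in \<open>auto simp: Complex_eq intro!: continuous_intros\<close>)
    then have "(\<lambda>v. f (Complex \<sigma> t + Complex x v)) \<in> borel_measurable borel"
      by (rule borel_measurable_continuous_onI)
    then show ?thesis
      unfolding g_def by measurable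
  qed
  have line: "norm (g L t w) \<le> D * (1 + \<bar>t\<bar>) powr p * exp (p\<^sup>2 / 2) * exp (Re w * L + (Re w)\<^sup>2) * exp (- (Im w)\<^sup>2 / 2)"
    if "norm (f (Complex (\<sigma> + Re w) (t + Im w))) \<le> D * (1 + \<bar>t + Im w\<bar>) powr p" "0 \<le> D" "0 \<le> p"
    for L t w D p
  proof -
    have "norm (g L t w) \<le> D * (1 + \<bar>t + Im w\<bar>) powr p * norm (gauss_kernel L w)"
      unfolding g_def norm_mult split by (rule mult_right_mono[OF that(1)]) auto
    also have "\<dots> \<le> D * ((1 + \<bar>t\<bar>) powr p * (exp (p\<^sup>2 / 2) * exp ((Im w)\<^sup>2 / 2))) * norm (gauss_kernel L w)"
      by (intro mult_left_mono mult_right_mono polynomial_growth_le_gaussian that) auto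
    also have "\<dots> = D * (1 + \<bar>t\<bar>) powr p * exp (p\<^sup>2 / 2) * exp (Re w * L + (Re w)\<^sup>2) *
        (exp ((Im w)\<^sup>2 / 2) * exp (- (Im w)\<^sup>2))"
      by (simp add: norm_gauss_kernel mult_ac)
    finally show ?thesis
      by (simp only: gauss)
  qed
  define C where "C = C\<^sub>0 * exp (\<epsilon>\<^sup>2 / 2) * exp ((\<sigma> / 2)\<^sup>2) / (\<sigma> / 2)"
  have "norm (f (Complex \<sigma> t) - perron (g L t) 2) \<le> C * exp (- (\<sigma> / 2) * L) * (1 + \<bar>t\<bar>) powr \<epsilon>" for L t
  proof -
    have "g L t 0 = perron (g L t) 2 - perron (g L t) (- (\<sigma> / 2))"
    proof (rule perron_shift[where r' = "- \<sigma>"])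
      show "g L t holomorphic_on {w. - \<sigma> < Re w}"
        unfolding g_def
        by (intro holomorphic_intros holomorphic_on_compose_gen[OF _ hol, unfolded o_def]) auto
      fix w assume w: "- (\<sigma> / 2) \<le> Re w" "Re w \<le> 2"
      have "norm (g L t w) \<le> \<bar>B\<bar> * (1 + \<bar>t\<bar>) powr \<bar>A\<bar> * exp (\<bar>A\<bar>\<^sup>2 / 2) * exp (Re w * L + (Re w)\<^sup>2) * exp (- (Im w)\<^sup>2 / 2)"
      proof (rule line)
        have "norm (f (Complex (\<sigma> + Re w) (t + Im w))) \<le> B * (1 + \<bar>t + Im w\<bar>) powr A"
          using w by (intro AB) auto
        also have "\<dots> \<le> \<bar>B\<bar> * (1 + \<bar>t + Im w\<bar>) powr \<bar>A\<bar>"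
          by (intro mult_mono powr_mono) auto
        finally show "norm (f (Complex (\<sigma> + Re w) (t + Im w))) \<le> \<bar>B\<bar> * (1 + \<bar>t + Im w\<bar>) powr \<bar>A\<bar>" .
      qed auto
      also have "\<dots> \<le> \<bar>B\<bar> * (1 + \<bar>t\<bar>) powr \<bar>A\<bar> * exp (\<bar>A\<bar>\<^sup>2 / 2) *
          exp ((2 + \<sigma>) * \<bar>L\<bar> + (2 + \<sigma>)\<^sup>2) * exp (- (Im w)\<^sup>2 / 2)"
        using w assms by (intro mult_left_mono mult_right_mono strip_exponent_le) auto
      finally show "norm (g L t w) \<le> \<dots>" .
    qed (use assms in auto)
    then have "norm (f (Complex \<sigma> t) - perron (g L t) 2) = norm (perron (g L t) (- (\<sigma> / 2)))"
      by (simp add: g_def)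
    also have "\<dots> \<le> (C\<^sub>0 * (1 + \<bar>t\<bar>) powr \<epsilon> * exp (\<epsilon>\<^sup>2 / 2) * exp (- (\<sigma> / 2) * L + (\<sigma> / 2)\<^sup>2)) / \<bar>- (\<sigma> / 2)\<bar>"
    proof (rule perron_integrable(2))
      show "norm (g L t (Complex (- (\<sigma> / 2)) v)) \<le> 
         C\<^sub>0 * (1 + \<bar>t\<bar>) powr \<epsilon> * exp (\<epsilon>\<^sup>2 / 2) * exp (- (\<sigma> / 2) * L + (\<sigma> / 2)\<^sup>2) * exp (- v\<^sup>2 / 2)" for v
        using line[of "Complex (- (\<sigma> / 2)) v" t C\<^sub>0 \<epsilon> L] C0 assms by simp
    qed (use assms meas in auto)
    also have "\<dots> = C * exp (- (\<sigma> / 2) * L) * (1 + \<bar>t\<bar>) powr \<epsilon>"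
      unfolding C_def exp_add using assms by (simp add: mult_ac)
    finally show ?thesis .
  qed
  moreover have "0 \<le> C"
    using C0 assms by (simp add: C_def)
  ultimately show ?thesis
    using that unfolding g_def by blast
qed

section \<open>Mean squares over symmetric intervals\<close>

definition interval_mean_square :: "(real \<Rightarrow> complex) \<Rightarrow> real \<Rightarrow> real" where
  "interval_mean_square g T = 1 / (2 * T) * integral {-T..T} (\<lambda>t. (norm (g t))\<^sup>2)"

text \<open>With \<open>x = |F| - |D|\<close> one has \<open>|F|\<^sup>2 - |D|\<^sup>2 = x\<^sup>2 + 2 |D| x\<close> and \<open>2 |D| \<le> 1 + |D|\<^sup>2\<close>. The bound
  needs the mean square of \<open>D\<close> only, so that an approximation with known mean square suffices.\<close>

lemma interval_mean_square_perturb: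
  assumes "0 < T" "0 \<le> E"
    and F: "(\<lambda>t. (norm (F t))\<^sup>2) integrable_on {-T..T}" and D: "(\<lambda>t. (norm (D t))\<^sup>2) integrable_on {-T..T}"
    and close: "\<And>t. \<bar>t\<bar> \<le> T \<Longrightarrow> norm (F t - D t) \<le> E"
  shows "\<bar>interval_mean_square F T - interval_mean_square D T\<bar> \<le> E\<^sup>2 + E + E * interval_mean_square D T"
proof -
  have "\<bar>integral {-T..T} (\<lambda>t. (norm (F t))\<^sup>2 - (norm (D t))\<^sup>2)\<bar>
      \<le> integral {-T..T} (\<lambda>t. E\<^sup>2 + E + E * (norm (D t))\<^sup>2)"
    unfolding real_norm_def[symmetric]
  proof (rule integral_norm_bound_integral)
    fix t assume "t \<in> {-T..T}"
    then have "\<bar>norm (F t) - norm (D t)\<bar> \<le> E"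
      using norm_triangle_ineq3 close[of t] by (force simp: abs_le_iff intro: order_trans)
    moreover define x y where "x = norm (F t) - norm (D t)" and "y = norm (D t)"
    ultimately have x: "\<bar>x\<bar> \<le> E" and y: "0 \<le> y"
      by auto
    have "(norm (F t))\<^sup>2 - (norm (D t))\<^sup>2 = x\<^sup>2 + 2 * y * x"
      by (simp add: x_def y_def power2_eq_square algebra_simps)
    also have "\<bar>\<dots>\<bar> \<le> \<bar>x\<bar>\<^sup>2 + 2 * y * \<bar>x\<bar>"
      using y abs_triangle_ineq[of "x\<^sup>2" "2 * y * x"] by (simp add: abs_mult)
    also have "\<dots> \<le> E\<^sup>2 + 2 * y * E"
      using x y by (intro add_mono power_mono mult_left_mono) auto
    also have "\<dots> \<le> E\<^sup>2 + (1 + y\<^sup>2) * E"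
      using sum_squares_bound[of 1 y] assms by (intro add_left_mono mult_right_mono) auto
    finally show "norm ((norm (F t))\<^sup>2 - (norm (D t))\<^sup>2) \<le> E\<^sup>2 + E + E * (norm (D t))\<^sup>2"
      by (simp add: y_def algebra_simps)
  qed (use F D in \<open>auto intro!: integrable_diff integrable_add integrable_on_mult_right\<close>)
  also have "\<dots> = 2 * T * (E\<^sup>2 + E) + E * integral {-T..T} (\<lambda>t. (norm (D t))\<^sup>2)"
    using D assms by (subst Henstock_Kurzweil_Integration.integral_add) (auto intro!: integrable_on_mult_right)
  finally have "\<bar>integral {-T..T} (\<lambda>t. (norm (F t))\<^sup>2) - integral {-T..T} (\<lambda>t. (norm (D t))\<^sup>2)\<bar>
      \<le> 2 * T * (E\<^sup>2 + E) + E * integral {-T..T} (\<lambda>t. (norm (D t))\<^sup>2)"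
    using F D by (simp add: Henstock_Kurzweil_Integration.integral_diff)
  then have "1 / (2 * T) * \<bar>integral {-T..T} (\<lambda>t. (norm (F t))\<^sup>2) - integral {-T..T} (\<lambda>t. (norm (D t))\<^sup>2)\<bar>
      \<le> 1 / (2 * T) * (2 * T * (E\<^sup>2 + E) + E * integral {-T..T} (\<lambda>t. (norm (D t))\<^sup>2))"
    using assms by (intro mult_left_mono) auto
  also have "\<dots> = E\<^sup>2 + E + E * interval_mean_square D T"
    using assms by (simp add: interval_mean_square_def field_simps)
  also have "1 / (2 * T) * \<bar>integral {-T..T} (\<lambda>t. (norm (F t))\<^sup>2) - integral {-T..T} (\<lambda>t. (norm (D t))\<^sup>2)\<bar>
      = \<bar>interval_mean_square F T - interval_mean_square D T\<bar>"
    using assms by (simp add: interval_mean_square_def flip: diff_divide_distrib)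
  finally show ?thesis .
qed

lemma norm_integral_cis_le:
  assumes "a \<noteq> 0" "0 \<le> T"
  shows "norm (integral {-T..T} (\<lambda>t. cis (a * t))) \<le> 2 / \<bar>a\<bar>"
proof -
  define G where "G t = cis (a * t) / (\<i> * a)" for t
  have "(G has_vector_derivative cis (a * t)) (at t within {-T..T})" for t
  proof -
    have "((\<lambda>z. exp (\<i> * a * z) / (\<i> * a)) has_field_derivative exp (\<i> * a * of_real t)) (at (of_real t))"
      using assms(1) by (auto intro!: derivative_eq_intros)
    from has_vector_derivative_real_field[OF this] show ?thesis
      by (simp add: G_def[abs_def] cis_conv_exp mult.assoc)
  qed
  then have "((\<lambda>t. cis (a * t)) has_integral (G T - G (-T))) {-T..T}"
    using assms by (intro fundamental_theorem_of_calculus) auto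
  then have "norm (integral {-T..T} (\<lambda>t. cis (a * t))) \<le> norm (G T) + norm (G (-T))"
    using norm_triangle_ineq4 by (simp add: integral_unique)
  also have "\<dots> = 2 / \<bar>a\<bar>"
    by (simp add: G_def norm_divide norm_mult)
  finally show ?thesis .
qed

abbreviation lnS :: "nat \<Rightarrow> real" where
  "lnS n \<equiv> ln (real (Suc n))"

text \<open>From \<open>ln x \<le> x - 1\<close> at \<open>x = (n + 1) / (m + 1)\<close>. The symmetric product form is crude, but
  it makes the double sum over the off-diagonal terms a perfect square.\<close>

lemma ln_separation:
  assumes "m \<noteq> n"
  shows "1 / \<bar>lnS m - lnS n\<bar> \<le> real (Suc m) * real (Suc n)"
proof -
  have *: "1 / \<bar>lnS m - lnS n\<bar> \<le> real (Suc m) * real (Suc n)" if "n < m" for m n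
  proof -
    have "1 / real (Suc m) \<le> 1 - real (Suc n) / real (Suc m)"
      using that by (simp add: field_simps)
    also have "\<dots> \<le> - ln (real (Suc n) / real (Suc m))"
      using ln_le_minus_one[of "real (Suc n) / real (Suc m)"] by simp
    also have "\<dots> = lnS m - lnS n"
      by (simp add: ln_div)
    finally have l: "1 / real (Suc m) \<le> lnS m - lnS n" .
    have "0 < 1 / real (Suc m)"
      by simp
    with l have "0 < lnS m - lnS n"
      by (rule less_le_trans[rotated])
    then have "1 / \<bar>lnS m - lnS n\<bar> \<le> 1 / (1 / real (Suc m))"
      using l by (intro divide_left_mono) (auto simp del: of_nat_Suc)
    also have "\<dots> \<le> real (Suc m) * real (Suc n)"
      by simp
    finally show ?thesis .
  qed
  show ?thesis
  proof (cases "n < m")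
    case False
    then have "m < n" using assms by simp
    from *[OF this] show ?thesis
      by (simp only: abs_minus_commute mult.commute)
  qed (rule *)
qed

text \<open>Expanding the square, the diagonal terms integrate to \<open>2 T |b n|\<^sup>2\<close>, and each off-diagonal term
  oscillates with frequency \<open>ln (n + 1) - ln (m + 1)\<close>, which is bounded away from 0.\<close>

lemma dirichlet_polynomial_mean_square:
  fixes b :: "nat \<Rightarrow> complex"
  assumes "0 < T"
  shows "\<bar>interval_mean_square (\<lambda>t. \<Sum>n<N. b n * cis (- t * lnS n)) T - (\<Sum>n<N. (norm (b n))\<^sup>2)\<bar>
    \<le> (\<Sum>n<N. real (Suc n) * norm (b n))\<^sup>2 / T"
proof -
  define I where "I m n = integral {-T..T} (\<lambda>t. cis ((lnS n - lnS m) * t))" for m n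
  \<comment> \<open>What remains of the integrals after removing the diagonal, which carries the main term.\<close>
  define E where "E m n = I m n - (if m = n then of_real (2 * T) else 0)" for m n
  define S where "S t = (\<Sum>n<N. b n * cis (- t * lnS n))" for t
  have E: "norm (E m n) \<le> 2 * (real (Suc m) * real (Suc n))" for m n
  proof (cases "m = n")
    case True
    then show ?thesis using assms by (simp add: E_def I_def scaleR_conv_of_real)
  next
    case False
    then have "norm (E m n) \<le> 2 / \<bar>lnS n - lnS m\<bar>"
      unfolding E_def I_def using assms norm_integral_cis_le[of "lnS n - lnS m" T] by auto
    also have "\<dots> = 2 * (1 / \<bar>lnS m - lnS n\<bar>)"
      by (simp add: abs_minus_commute)
    also have "\<dots> \<le> 2 * (real (Suc m) * real (Suc n))"
      using ln_separation[OF False] by (intro mult_left_mono) auto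
    finally show ?thesis .
  qed
  have ci: "(\<lambda>t. c * cis (a * t)) integrable_on {-T..T}" for a c
    by (intro integrable_continuous_real continuous_intros)
  have "of_real ((norm (S t))\<^sup>2) = (\<Sum>m<N. \<Sum>n<N. b m * cnj (b n) * cis ((lnS n - lnS m) * t))" for t
  proof -
    have "of_real ((norm (S t))\<^sup>2) = S t * cnj (S t)"
      by (rule complex_norm_square)
    also have "\<dots> = (\<Sum>m<N. \<Sum>n<N. (b m * cis (- t * lnS m)) * cnj (b n * cis (- t * lnS n)))"
      unfolding S_def cnj_sum sum_product ..
    also have "\<dots> = (\<Sum>m<N. \<Sum>n<N. b m * cnj (b n) * cis ((lnS n - lnS m) * t))"
    proof (intro sum.cong refl)
      fix m n
      have "cis (- t * lnS m) * cis (t * lnS n) = cis ((lnS n - lnS m) * t)"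
        unfolding cis_mult by (simp add: algebra_simps)
      then show "b m * cis (- t * lnS m) * cnj (b n * cis (- t * lnS n)) =
          b m * cnj (b n) * cis ((lnS n - lnS m) * t)"
        by (simp add: cis_cnj mult_ac del: cis_mult of_nat_Suc)
    qed
    finally show ?thesis .
  qed
  moreover have "((\<lambda>t. \<Sum>m<N. \<Sum>n<N. b m * cnj (b n) * cis ((lnS n - lnS m) * t)) has_integral
      (\<Sum>m<N. \<Sum>n<N. b m * cnj (b n) * I m n)) {-T..T}"
  proof (intro has_integral_sum finite_lessThan)
    fix m n
    have "(\<lambda>t. cis ((lnS n - lnS m) * t)) integrable_on {-T..T}"
      using ci[of 1] by simp
    then show "((\<lambda>t. b m * cnj (b n) * cis ((lnS n - lnS m) * t)) has_integral b m * cnj (b n) * I m n) {-T..T}"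
      unfolding I_def by (intro has_integral_mult_right integrable_integral)
  qed
  ultimately have "((\<lambda>t. of_real ((norm (S t))\<^sup>2)) has_integral (\<Sum>m<N. \<Sum>n<N. b m * cnj (b n) * I m n)) {-T..T}"
    by simp
  moreover have "((\<lambda>t. of_real ((norm (S t))\<^sup>2)) has_integral complex_of_real (integral {-T..T} (\<lambda>t. (norm (S t))\<^sup>2))) {-T..T}"
    unfolding S_def
    by (intro has_integral_of_real integrable_integral integrable_continuous_real continuous_intros)
  ultimately have "of_real (integral {-T..T} (\<lambda>t. (norm (S t))\<^sup>2)) = (\<Sum>m<N. \<Sum>n<N. b m * cnj (b n) * I m n)"
    by (rule has_integral_unique[rotated])
  also have "\<dots> = (\<Sum>m<N. \<Sum>n<N. b m * cnj (b n) * E m n) + (\<Sum>m<N. b m * cnj (b m) * of_real (2 * T))"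
  proof -
    have "b m * cnj (b n) * I m n = b m * cnj (b n) * E m n + (if m = n then b m * cnj (b n) * of_real (2 * T) else 0)" for m n
      by (simp add: E_def algebra_simps)
    then show ?thesis
      by (simp add: sum.distrib sum.delta)
  qed
  also have "(\<Sum>m<N. b m * cnj (b m) * of_real (2 * T)) = of_real (2 * T * (\<Sum>m<N. (norm (b m))\<^sup>2))"
    unfolding complex_norm_square[symmetric] by (simp add: sum_distrib_left mult_ac)
  finally have "norm (complex_of_real (integral {-T..T} (\<lambda>t. (norm (S t))\<^sup>2)) - of_real (2 * T * (\<Sum>m<N. (norm (b m))\<^sup>2)))
      = norm (\<Sum>m<N. \<Sum>n<N. b m * cnj (b n) * E m n)"
    by simp
  also have "\<dots> \<le> (\<Sum>m<N. \<Sum>n<N. norm (b m) * norm (b n) * (2 * (real (Suc m) * real (Suc n))))"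
    by (intro sum_norm_le) (auto simp: norm_mult simp del: of_nat_Suc intro!: mult_left_mono E)
  also have "\<dots> = 2 * (\<Sum>n<N. real (Suc n) * norm (b n))\<^sup>2"
    unfolding power2_eq_square sum_product by (simp only: sum_distrib_left) (simp only: mult_ac)
  finally have "\<bar>integral {-T..T} (\<lambda>t. (norm (S t))\<^sup>2) - 2 * T * (\<Sum>m<N. (norm (b m))\<^sup>2)\<bar>
      \<le> 2 * (\<Sum>n<N. real (Suc n) * norm (b n))\<^sup>2"
    by (simp only: norm_of_real flip: of_real_diff)
  then have "\<bar>integral {-T..T} (\<lambda>t. (norm (S t))\<^sup>2) - 2 * T * (\<Sum>m<N. (norm (b m))\<^sup>2)\<bar> / (2 * T)
      \<le> 2 * (\<Sum>n<N. real (Suc n) * norm (b n))\<^sup>2 / (2 * T)"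
    using assms by (intro divide_right_mono) auto
  also have "\<bar>integral {-T..T} (\<lambda>t. (norm (S t))\<^sup>2) - 2 * T * (\<Sum>m<N. (norm (b m))\<^sup>2)\<bar> / (2 * T) =
      \<bar>(integral {-T..T} (\<lambda>t. (norm (S t))\<^sup>2) - 2 * T * (\<Sum>m<N. (norm (b m))\<^sup>2)) / (2 * T)\<bar>"
    using assms by simp
  also have "(integral {-T..T} (\<lambda>t. (norm (S t))\<^sup>2) - 2 * T * (\<Sum>m<N. (norm (b m))\<^sup>2)) / (2 * T)
      = interval_mean_square S T - (\<Sum>n<N. (norm (b n))\<^sup>2)"
    using assms by (simp add: interval_mean_square_def diff_divide_distrib)
  finally show ?thesis
    by (simp only: S_def[abs_def])
qed

lemma dirichlet_series_mean_square:
  fixes b :: "nat \<Rightarrow> complex"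
  assumes sum: "summable (\<lambda>n. real (Suc n) * norm (b n))" and T: "0 < T"
  shows "(\<lambda>t. (norm (\<Sum>n. b n * cis (- t * lnS n)))\<^sup>2) integrable_on {-T..T}"
    and "\<bar>interval_mean_square (\<lambda>t. \<Sum>n. b n * cis (- t * lnS n)) T - (\<Sum>n. (norm (b n))\<^sup>2)\<bar>
      \<le> (\<Sum>n. real (Suc n) * norm (b n))\<^sup>2 / T"
proof -
  define P where "P N t = (\<Sum>n<N. b n * cis (- t * lnS n))" for N t
  define Q where "Q = (\<Sum>n. real (Suc n) * norm (b n))"
  have nb: "norm (b n) \<le> real (Suc n) * norm (b n)" for n
    by (simp add: algebra_simps)
  have sb: "summable (\<lambda>n. norm (b n))"
    by (rule summable_comparison_test'[OF sum]) (use nb in auto)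
  have ser: "summable (\<lambda>n. b n * cis (- t * lnS n))" for t
    by (rule summable_comparison_test'[OF sb]) (auto simp: norm_mult)
  have P_lim: "(\<lambda>N. P N t) \<longlonglongrightarrow> (\<Sum>n. b n * cis (- t * lnS n))" for t
    unfolding P_def by (rule summable_LIMSEQ[OF ser])
  have P_bound: "norm (P N t) \<le> Q" for N t
  proof -
    have "norm (P N t) \<le> (\<Sum>n<N. real (Suc n) * norm (b n))"
      unfolding P_def by (rule sum_norm_le) (use nb in \<open>auto simp: norm_mult\<close>)
    also have "\<dots> \<le> Q"
      unfolding Q_def by (rule sum_le_suminf[OF sum]) auto
    finally show ?thesis .
  qed
  have dom: "(\<lambda>t. (norm (\<Sum>n. b n * cis (- t * lnS n)))\<^sup>2) integrable_on {-T..T}"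
    "(\<lambda>N. integral {-T..T} (\<lambda>t. (norm (P N t))\<^sup>2))
      \<longlonglongrightarrow> integral {-T..T} (\<lambda>t. (norm (\<Sum>n. b n * cis (- t * lnS n)))\<^sup>2)"
  proof -
    have 1: "(\<lambda>t. (norm (P N t))\<^sup>2) integrable_on {-T..T}" for N
      unfolding P_def by (intro integrable_continuous_real continuous_intros)
    have 2: "(\<lambda>t::real. Q\<^sup>2) integrable_on {-T..T}"
      by (intro integrable_continuous_real continuous_intros)
    have 3: "norm ((norm (P N t))\<^sup>2) \<le> Q\<^sup>2" for N t
      using P_bound[of N t] by (simp add: power_mono)
    have 4: "(\<lambda>N. (norm (P N t))\<^sup>2) \<longlonglongrightarrow> (norm (\<Sum>n. b n * cis (- t * lnS n)))\<^sup>2" for t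
      by (intro tendsto_intros P_lim)
    show "(\<lambda>t. (norm (\<Sum>n. b n * cis (- t * lnS n)))\<^sup>2) integrable_on {-T..T}"
      "(\<lambda>N. integral {-T..T} (\<lambda>t. (norm (P N t))\<^sup>2))
        \<longlonglongrightarrow> integral {-T..T} (\<lambda>t. (norm (\<Sum>n. b n * cis (- t * lnS n)))\<^sup>2)"
      by (rule dominated_convergence[OF 1 2 3 4])+
  qed
  show "(\<lambda>t. (norm (\<Sum>n. b n * cis (- t * lnS n)))\<^sup>2) integrable_on {-T..T}"
    by (rule dom)
  have sq: "summable (\<lambda>n. (norm (b n))\<^sup>2)"
  proof (rule summable_comparison_test_ev[OF _ sb])
    have "\<forall>\<^sub>F n in sequentially. norm (b n) < 1"
      using summable_LIMSEQ_zero[OF sb] by (rule order_tendstoD) simp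
    then show "\<forall>\<^sub>F n in sequentially. norm ((norm (b n))\<^sup>2) \<le> norm (b n)"
      by eventually_elim (simp add: power2_eq_square mult_left_le)
  qed
  have "(\<lambda>N. \<bar>interval_mean_square (P N) T - (\<Sum>n<N. (norm (b n))\<^sup>2)\<bar>)
      \<longlonglongrightarrow> \<bar>interval_mean_square (\<lambda>t. \<Sum>n. b n * cis (- t * lnS n)) T - (\<Sum>n. (norm (b n))\<^sup>2)\<bar>"
    unfolding interval_mean_square_def by (intro tendsto_intros dom summable_LIMSEQ sq)
  then show "\<bar>interval_mean_square (\<lambda>t. \<Sum>n. b n * cis (- t * lnS n)) T - (\<Sum>n. (norm (b n))\<^sup>2)\<bar>
      \<le> (\<Sum>n. real (Suc n) * norm (b n))\<^sup>2 / T"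
  proof (rule LIMSEQ_le_const2, intro exI allI impI)
    fix N
    have "\<bar>interval_mean_square (P N) T - (\<Sum>n<N. (norm (b n))\<^sup>2)\<bar> \<le> (\<Sum>n<N. real (Suc n) * norm (b n))\<^sup>2 / T"
      using dirichlet_polynomial_mean_square[OF T, where b = b] unfolding P_def by simp
    also have "\<dots> \<le> (\<Sum>n. real (Suc n) * norm (b n))\<^sup>2 / T"
      using T by (intro divide_right_mono power_mono sum_le_suminf[OF sum] sum_nonneg) auto
    finally show "\<bar>interval_mean_square (P N) T - (\<Sum>n<N. (norm (b n))\<^sup>2)\<bar> \<le> \<dots>" .
  qed
qed

section \<open>Dirichlet series with square summable coefficients\<close>

text \<open>Absolute convergence at the point 1, hence on every line further to the right, which follows from \<open>2 x y \<le> x\<^sup>2 + y\<^sup>2\<close>.\<close>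

lemma H2_summable:
  assumes "a \<in> H2"
  shows "summable (\<lambda>n. norm (a (Suc n)) * exp (- lnS n))"
proof (rule summable_comparison_test')
  show "summable (\<lambda>n. (norm (a (Suc n)))\<^sup>2 + 1 / real (Suc n) ^ 2)"
    using assms inverse_power_summable[of 2, where 'a = real]
    by (intro summable_add) (auto simp: H2_def inverse_eq_divide summable_Suc_iff[of "\<lambda>n. 1 / real n ^ 2"] simp del: of_nat_Suc)
  fix n
  define p where "p = norm (a (Suc n)) * (1 / real (Suc n))"
  have "0 \<le> p" "2 * p \<le> (norm (a (Suc n)))\<^sup>2 + 1 / real (Suc n) ^ 2"
    using sum_squares_bound[of "norm (a (Suc n))" "1 / real (Suc n)"]
    by (simp_all add: p_def power_divide del: of_nat_Suc)
  moreover have "norm (norm (a (Suc n)) * exp (- lnS n)) = p"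
    by (simp add: p_def exp_minus inverse_eq_divide del: of_nat_Suc)
  ultimately show "norm (norm (a (Suc n)) * exp (- lnS n)) \<le> (norm (a (Suc n)))\<^sup>2 + 1 / real (Suc n) ^ 2"
    by linarith
qed

lemma dirichlet_term_eq: "dirichlet_term a s n = a (Suc n) * exp (- s * lnS n)"
proof -
  have "Ln (complex_of_nat (Suc n)) = of_real (lnS n)"
    using Ln_of_real[of "real (Suc n)"] by (simp del: of_nat_Suc)
  then show ?thesis
    by (simp add: dirichlet_term_def powr_def del: of_nat_Suc)
qed

text \<open>For \<open>Re w = 2\<close> the argument of \<open>f\<close> lies in the region of absolute convergence, although
  \<open>Complex \<sigma> t\<close> itself may not. Here \<open>exp (- \<sigma> * lnS n) * cis (- t * lnS n)\<close> is the
  power of \<open>n + 1\<close> with exponent \<open>- Complex \<sigma> t\<close>.\<close>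

lemma smoothed_dirichlet_series:
  assumes a: "a \<in> H2" and f: "analytic_continuation_C0 a f" and \<sigma>: "0 < \<sigma>"
  shows "perron (\<lambda>w. f (Complex \<sigma> t + w) * gauss_kernel L w) 2 =
    (\<Sum>n. (a (Suc n) * exp (- \<sigma> * lnS n) * cutoff (L - lnS n)) * cis (- t * lnS n))"
proof -
  have le: "exp (- x * lnS n) \<le> exp (- lnS n)" if "1 \<le> x" for x n
    using mult_right_mono[OF that, of "lnS n"] by simp
  have ns: "norm (a (Suc n) * exp (- s * lnS n)) = norm (a (Suc n)) * exp (- Re s * lnS n)" for s :: complex and n
    by (simp add: norm_mult norm_exp_eq_Re)
  have abs: "summable (\<lambda>n. norm (a (Suc n) * exp (- s * lnS n)))" if "1 \<le> Re s" for s
    by (rule summable_comparison_test'[OF H2_summable[OF a]])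
       (simp only: real_norm_def abs_norm_cancel abs_mult abs_exp_cancel ns mult_left_mono[OF le[OF that] norm_ge_zero])
  define b where "b n = a (Suc n) * exp (- Complex \<sigma> t * lnS n)" for n
  have b_mult: "b n * exp (- w * lnS n) = a (Suc n) * exp (- (Complex \<sigma> t + w) * lnS n)" for n and w :: complex
    by (simp add: b_def algebra_simps flip: exp_add)
  have "(\<lambda>n. b n * cutoff (L - lnS n)) sums perron (\<lambda>w. f (Complex \<sigma> t + w) * gauss_kernel L w) 2"
  proof (rule perron_exponential_series)
    show "(\<lambda>n. b n * exp (- Complex 2 v * lnS n)) sums f (Complex \<sigma> t + Complex 2 v)" for v
    proof -
      let ?s = "Complex \<sigma> t + Complex 2 v"
      have "summable (\<lambda>n. a (Suc n) * exp (- ?s * lnS n))"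
        by (rule summable_norm_cancel[OF abs]) (use \<sigma> in simp)
      moreover have "?s \<in> half_plane 0"
        using \<sigma> by (simp add: half_plane_def)
      ultimately have "f ?s = (\<Sum>n. a (Suc n) * exp (- ?s * lnS n))"
        using f unfolding analytic_continuation_C0_def dirichlet_term_eq[abs_def] by blast
      with \<open>summable _\<close> show ?thesis
        unfolding b_mult by (simp only: summable_sums)
    qed
    have "norm (b n) * exp (- 2 * lnS n) = norm (a (Suc n) * exp (- Complex (\<sigma> + 2) t * lnS n))" for n
      unfolding b_def ns by (simp add: algebra_simps flip: exp_add)
    then show "summable (\<lambda>n. norm (b n) * exp (- 2 * lnS n))"
      using abs[of "Complex (\<sigma> + 2) t"] \<sigma> by simp
  qed
  moreover have "b n * cutoff (L - lnS n) = (a (Suc n) * exp (- \<sigma> * lnS n) * cutoff (L - lnS n)) * cis (- t * lnS n)" for n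
  proof -
    have "exp (- Complex \<sigma> t * lnS n) = exp (- \<sigma> * lnS n) * cis (- t * lnS n)"
      by (simp add: exp_eq_polar del: of_nat_Suc)
    then show ?thesis
      unfolding b_def by (simp only: mult_ac)
  qed
  ultimately show ?thesis
    by (simp only: sums_iff)
qed

section \<open>The mean value formula\<close>

text \<open>Tannery's theorem with a majorant that is valid for all indices, a form in which it can be applied
  without product filters.\<close>

lemma suminf_tendsto_dominated:
  fixes a :: "'b \<Rightarrow> nat \<Rightarrow> 'a :: {real_normed_algebra, banach}"
  assumes "\<And>k. ((\<lambda>x. a x k) \<longlongrightarrow> b k) F" "eventually (\<lambda>x. \<forall>k. norm (a x k) \<le> M k) F"
    and "summable M" "F \<noteq> bot"
  shows "((\<lambda>x. suminf (a x)) \<longlongrightarrow> suminf b) F"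
proof -
  have "eventually (\<lambda>(k, x). norm (a x k) \<le> M k) (at_top \<times>\<^sub>F F)"
    unfolding eventually_prod_filter using assms(2)
    by (intro exI[of _ "\<lambda>_. True"] exI[of _ "\<lambda>x. \<forall>k. norm (a x k) \<le> M k"]) auto
  then show ?thesis
    using tannerys_theorem[of "\<lambda>k x. a x k" b F M] assms by auto
qed

text \<open>Carlson's mean value formula. The truncation point \<open>exp (L T) = T powr (1 / 8)\<close> of the series
  \<open>D T\<close> grows with the interval. It must be large enough for
  the smoothing error \<open>E T\<close> to vanish, which requires \<open>\<epsilon> < \<sigma> / 16\<close> in the growth bound for
  \<open>f\<close>, and small enough for the off-diagonal terms, of size \<open>exp (4 * L T) / T\<close>, to vanish.\<close>

lemma mean_square_tendsto:
  assumes a: "a \<in> H2" and ac: "analytic_continuation_C0 a f" and oz: "order_zero 0 f" and \<sigma>: "0 < \<sigma>"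
  shows "(mean_square f \<sigma> \<longlongrightarrow> (\<Sum>n. (norm (a (Suc n)) * exp (- \<sigma> * lnS n))\<^sup>2)) at_top"
proof -
  obtain C where C: "0 \<le> C" "\<And>L t. norm (f (Complex \<sigma> t) - perron (\<lambda>w. f (Complex \<sigma> t + w) * gauss_kernel L w) 2)
        \<le> C * exp (- (\<sigma> / 2) * L) * (1 + \<bar>t\<bar>) powr (\<sigma> / 32)"
    using smoothing_error[OF oz \<sigma>, of "\<sigma> / 32"] \<sigma> by auto
  define F where "F t = f (Complex \<sigma> t)" for t
  define L where "L T = ln T / 8" for T :: real
  define b where "b T n = a (Suc n) * exp (- \<sigma> * lnS n) * cutoff (L T - lnS n)" for T n
  define D where "D T t = (\<Sum>n. b T n * cis (- t * lnS n))" for T t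
  define E where "E T = C * (exp (- (\<sigma> / 16) * ln T) * (1 + T) powr (\<sigma> / 32))" for T
  define q where "q = (\<Sum>n. norm (a (Suc n)) * exp (- lnS n))"
  have L_lim: "filterlim L at_top at_top"
    unfolding L_def by real_asymp
  have a2: "summable (\<lambda>n. (norm (a (Suc n)))\<^sup>2)"
    using a by (simp add: H2_def)
  have exp_le: "exp (- \<sigma> * lnS n) \<le> 1" for n
    using \<sigma> by simp
  have nb: "norm (b T n) = norm (a (Suc n)) * exp (- \<sigma> * lnS n) * norm (cutoff (L T - lnS n))" for T n
    by (simp add: b_def norm_mult)
  have b_weighted: "real (Suc n) * norm (b T n) \<le> exp (2 * L T + 4) * (norm (a (Suc n)) * exp (- lnS n))" for T n
  proof -
    have "real (Suc n) * norm (b T n) \<le> real (Suc n) * (norm (a (Suc n)) * 1 * exp (2 * (L T - lnS n) + 4))"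
      unfolding nb by (intro mult_left_mono mult_mono exp_le cutoff_decay) auto
    also have "\<dots> = norm (a (Suc n)) * (exp (lnS n) * exp (2 * (L T - lnS n) + 4))"
      by simp
    also have "\<dots> = exp (2 * L T + 4) * (norm (a (Suc n)) * exp (- lnS n))"
      by (simp add: algebra_simps del: of_nat_Suc exp_ln flip: exp_add)
    finally show ?thesis .
  qed
  have b_sum: "summable (\<lambda>n. real (Suc n) * norm (b T n))" for T
    by (rule summable_comparison_test'[OF summable_mult[OF H2_summable[OF a], of "exp (2 * L T + 4)"]])
       (use b_weighted in auto)
  have D_ms: "\<bar>interval_mean_square (D T) T - (\<Sum>n. (norm (b T n))\<^sup>2)\<bar> \<le> (exp (2 * L T + 4) * q)\<^sup>2 / T"
    if "0 < T" for T
  proof -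
    have "(\<Sum>n. real (Suc n) * norm (b T n)) \<le> (\<Sum>n. exp (2 * L T + 4) * (norm (a (Suc n)) * exp (- lnS n)))"
      by (intro suminf_le b_weighted b_sum summable_mult H2_summable a)
    also have "\<dots> = exp (2 * L T + 4) * q"
      unfolding q_def by (rule suminf_mult[OF H2_summable[OF a]])
    finally have "(\<Sum>n. real (Suc n) * norm (b T n))\<^sup>2 / T \<le> (exp (2 * L T + 4) * q)\<^sup>2 / T"
      using that by (intro divide_right_mono power_mono suminf_nonneg b_sum) auto
    then show ?thesis
      using dirichlet_series_mean_square(2)[OF b_sum that, of T] unfolding D_def by simp
  qed
  have b_lim: "((\<lambda>T. \<Sum>n. (norm (b T n))\<^sup>2) \<longlongrightarrow> (\<Sum>n. (norm (a (Suc n)) * exp (- \<sigma> * lnS n))\<^sup>2)) at_top"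
  proof (rule suminf_tendsto_dominated)
    show "((\<lambda>T. (norm (b T n))\<^sup>2) \<longlongrightarrow> (norm (a (Suc n)) * exp (- \<sigma> * lnS n))\<^sup>2) at_top" for n
    proof -
      have "filterlim (\<lambda>T. - lnS n + L T) at_top at_top"
        by (rule filterlim_tendsto_add_at_top[OF tendsto_const L_lim])
      then have "((\<lambda>T. cutoff (L T - lnS n)) \<longlongrightarrow> 1) at_top"
        by (intro filterlim_compose[OF cutoff_tendsto_one]) (simp add: add.commute)
      then have "((\<lambda>T. (norm (b T n))\<^sup>2) \<longlongrightarrow> (norm (a (Suc n)) * exp (- \<sigma> * lnS n) * norm (1::complex))\<^sup>2) at_top"
        unfolding nb by (intro tendsto_intros)
      then show ?thesis by simp
    qed
    have "(norm (b T n))\<^sup>2 \<le> (norm (a (Suc n)) * 1 * exp 4)\<^sup>2" for T n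
      unfolding nb by (intro power_mono mult_mono exp_le cutoff_bounded) auto
    then show "\<forall>\<^sub>F T in at_top. \<forall>n. norm ((norm (b T n))\<^sup>2) \<le> (norm (a (Suc n)))\<^sup>2 * (exp 4)\<^sup>2"
      by (simp add: power_mult_distrib)
    show "summable (\<lambda>n. (norm (a (Suc n)))\<^sup>2 * (exp 4)\<^sup>2)"
      by (rule summable_mult2[OF a2])
  qed auto
  have "((\<lambda>T. (exp (2 * L T + 4))\<^sup>2 / T) \<longlongrightarrow> 0) at_top"
    unfolding L_def by real_asymp
  from tendsto_mult[OF this tendsto_const[of "q\<^sup>2"]]
  have "((\<lambda>T. (exp (2 * L T + 4) * q)\<^sup>2 / T) \<longlongrightarrow> 0) at_top"
    by (simp add: power_mult_distrib)
  then have "((\<lambda>T. interval_mean_square (D T) T - (\<Sum>n. (norm (b T n))\<^sup>2)) \<longlongrightarrow> 0) at_top"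
    by (rule Lim_null_comparison[rotated])
       (rule eventually_mono[OF eventually_gt_at_top[of 0]], simp add: D_ms)
  from tendsto_add[OF this b_lim]
  have D_lim: "((\<lambda>T. interval_mean_square (D T) T) \<longlongrightarrow> (\<Sum>n. (norm (a (Suc n)) * exp (- \<sigma> * lnS n))\<^sup>2)) at_top"
    by simp
  have E_lim: "(E \<longlongrightarrow> 0) at_top"
  proof -
    have "((\<lambda>T. exp (- (\<sigma> / 16) * ln T) * (1 + T) powr (\<sigma> / 32)) \<longlongrightarrow> 0) at_top"
      using \<sigma> by real_asymp
    from tendsto_mult[OF tendsto_const[of C] this] show ?thesis
      unfolding E_def by simp
  qed
  have F_int: "(\<lambda>t. (norm (F t))\<^sup>2) integrable_on {-T..T}" for T
  proof -
    have "f holomorphic_on {s. Re s > 0}"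
      using oz by (auto simp: order_zero_def finite_order_def half_plane_def intro: analytic_imp_holomorphic)
    then have "continuous_on {-T..T} F"
      unfolding F_def
      by (rule continuous_on_compose2[OF holomorphic_on_imp_continuous_on])
         (use \<sigma> in \<open>auto simp: Complex_eq intro!: continuous_intros\<close>)
    then show ?thesis
      by (intro integrable_continuous_real continuous_intros)
  qed
  have close: "\<bar>interval_mean_square F T - interval_mean_square (D T) T\<bar>
      \<le> (E T)\<^sup>2 + E T + E T * interval_mean_square (D T) T" if "0 < T" for T
  proof (rule interval_mean_square_perturb[OF that _ F_int])
    show "0 \<le> E T"
      using C by (simp add: E_def)
    show "(\<lambda>t. (norm (D T t))\<^sup>2) integrable_on {-T..T}"
      unfolding D_def by (rule dirichlet_series_mean_square(1)[OF b_sum that])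
    fix t assume t: "\<bar>t\<bar> \<le> T"
    have "norm (F t - D T t) \<le> C * exp (- (\<sigma> / 2) * L T) * (1 + \<bar>t\<bar>) powr (\<sigma> / 32)"
      using C(2)[of t "L T"] smoothed_dirichlet_series[OF a ac \<sigma>, of t "L T"]
      unfolding F_def D_def b_def by simp
    also have "\<dots> \<le> C * exp (- (\<sigma> / 2) * L T) * (1 + T) powr (\<sigma> / 32)"
      using t \<sigma> C(1) by (intro mult_left_mono powr_mono2) auto
    also have "\<dots> = E T"
      by (simp add: E_def L_def)
    finally show "norm (F t - D T t) \<le> E T" .
  qed
  have "((\<lambda>T. (E T)\<^sup>2) \<longlongrightarrow> 0) at_top" "((\<lambda>T. E T * interval_mean_square (D T) T) \<longlongrightarrow> 0) at_top"
    using tendsto_power[OF E_lim, of 2] tendsto_mult[OF E_lim D_lim] by simp_all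
  then have "((\<lambda>T. (E T)\<^sup>2 + E T + E T * interval_mean_square (D T) T) \<longlongrightarrow> 0) at_top"
    using E_lim by (intro tendsto_add_zero)
  moreover have "\<forall>\<^sub>F T in at_top. norm (interval_mean_square F T - interval_mean_square (D T) T)
      \<le> (E T)\<^sup>2 + E T + E T * interval_mean_square (D T) T"
    unfolding real_norm_def using eventually_gt_at_top[of 0] by (rule eventually_mono) (rule close)
  ultimately have "((\<lambda>T. interval_mean_square F T - interval_mean_square (D T) T) \<longlongrightarrow> 0) at_top"
    by (rule Lim_null_comparison[rotated])
  from tendsto_add[OF this D_lim] show ?thesis
    by (simp add: interval_mean_square_def[abs_def] mean_square_def[abs_def] F_def)
qed

theorem corollary2:
  fixes a :: "nat \<Rightarrow> complex" and f :: "complex \<Rightarrow> complex"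
  assumes "a \<in> H2"
    and "analytic_continuation_C0 a f"
    and "order_zero 0 f"
  shows "\<exists>M :: real \<Rightarrow> real.
           (\<forall>\<sigma>>0. (mean_square f \<sigma> \<longlongrightarrow> M \<sigma>) at_top) \<and>
           (M \<longlongrightarrow> (H2_norm a)\<^sup>2) (at_right 0)"
proof (intro exI conjI allI impI)
  let ?M = "\<lambda>\<sigma>. \<Sum>n. (norm (a (Suc n)) * exp (- \<sigma> * lnS n))\<^sup>2"
  show "(mean_square f \<sigma> \<longlongrightarrow> ?M \<sigma>) at_top" if "0 < \<sigma>" for \<sigma>
    by (rule mean_square_tendsto[OF assms that])
  have a2: "summable (\<lambda>n. (norm (a (Suc n)))\<^sup>2)"
    using assms(1) by (simp add: H2_def)
  have "(?M \<longlongrightarrow> (\<Sum>n. (norm (a (Suc n)))\<^sup>2)) (at_right 0)"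
  proof (rule suminf_tendsto_dominated[OF _ _ a2])
    show "((\<lambda>\<sigma>. (norm (a (Suc n)) * exp (- \<sigma> * lnS n))\<^sup>2) \<longlongrightarrow> (norm (a (Suc n)))\<^sup>2) (at_right 0)" for n
    proof -
      have "((\<lambda>\<sigma>. (norm (a (Suc n)) * exp (- \<sigma> * lnS n))\<^sup>2) \<longlongrightarrow> (norm (a (Suc n)) * exp (- 0 * lnS n))\<^sup>2) (at_right 0)"
        by (intro tendsto_intros)
      then show ?thesis by simp
    qed
    have "(norm (a (Suc n)) * exp (- \<sigma> * lnS n))\<^sup>2 \<le> (norm (a (Suc n)) * 1)\<^sup>2" if "0 < \<sigma>" for \<sigma> n
      using that by (intro power_mono mult_left_mono) auto
    then show "\<forall>\<^sub>F \<sigma> in at_right 0. \<forall>n. norm ((norm (a (Suc n)) * exp (- \<sigma> * lnS n))\<^sup>2) \<le> (norm (a (Suc n)))\<^sup>2"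
      by (intro eventually_mono[OF eventually_at_right_less]) simp
  qed simp
  then show "(?M \<longlongrightarrow> (H2_norm a)\<^sup>2) (at_right 0)"
    using suminf_nonneg[OF a2] by (simp add: H2_norm_def)
qed

end
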